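(* Let $m,n$ be positive integers with $m\mid n-1$, and let $(\Omega,\{C_0,\dots,C_{m-1},S_0,\dots,S_{m-1}\})$ be an association scheme of order $m(n+1)$, with $C_0=1_\Omega$, whose adjacency matrices satisfy (indices modulo $m$) $\underline{C}_i\underline{C}_j=\underline{C}_{i+j}$, $\underline{C}_i\underline{S}_j=\underline{S}_{i+j}$, $\underline{S}_j\underline{C}_i=\underline{S}_{j-i}$, $\underline{S}_i\underline{S}_j=n\underline{C}_{i-j}+\frac{n-1}{m}(\underline{S}_0+\dots+\underline{S}_{m-1})$. Let $E=C_0\cup\dots\cup C_{m-1}$ (an equivalence relation on $\Omega$), let $\Omega_1$ be any equivalence class of $E$ and $\Omega_2=\Omega\setminus\Omega_1$. For $i\in\mathbb{Z}_m$ set $S_i^b=S_i\cap(\Omega_1\times\Omega_2\cup\Omega_2\times\Omega_1)$ and $S_i^w=S_i\cap(\Omega_2\times\Omega_2)$. Then the relations $D_i:=C_i\cup C_{-i}$ for $0\le i\le m/2$ and $T_i:=S_i^b\cup S_{-i}^w$ for $i\in\mathbb{Z}_m$ form a proper Jordan scheme on $\Omega$.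
   Context: $1_\Omega=\{(\omega,\omega)\}$; $\underline{R}$ is the adjacency matrix of $R\subseteq\Omega^2$; $R(\alpha)=\{\beta:(\alpha,\beta)\in R\}$, $R^\top$ the transpose. A rainbow is a partition $\mathcal{C}$ of $\Omega^2$ such that $1_\Omega$ is a union of classes and $\mathcal{C}$ is closed under transposition. A coherent configuration is a rainbow in which $|C(\alpha)\cap D^\top(\beta)|$ depends only on the class of $(\alpha,\beta)$ (for all $C,D\in\mathcal{C}$); an association scheme is a coherent configuration with $1_\Omega\in\mathcal{C}$. A Jordan configuration is a rainbow such that for all $C,D\in\mathcal{C}$ and all pairs $(\alpha,\beta),(\alpha',\beta')$ in the same class, $|C(\alpha)\cap D^\top(\beta)|+|D(\alpha)\cap C^\top(\beta)|=|C(\alpha')\cap D^\top(\beta')|+|D(\alpha')\cap C^\top(\beta')|$; a Jordan scheme is one with $1_\Omega\in\mathcal{C}$. A coherent algebra is a subspace of $M_\Omega(\mathbb{R})$ containing the identity and all-one matrices, closed under transposition, matrix product and entrywise product; its symmetrization is its set of symmetric matrices. A Jordan configuration is proper if $\mathbb{R}\langle\underline{C}:C\in\mathcal{C}\rangle$ is not the symmetrization of any coherent algebra.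
   Formalization: The Jordan scheme is asserted for all positive m, n, but "proper" only for m ≥ 3 and n ≥ 2: for m = 1, m = 2 or n = 1 the span of the D_i and T_i is always the symmetrization of the coherent algebra of the given association scheme, so properness fails there. *)

theory Defs
  imports "HOL-Analysis.Analysis" "HOL-Library.Disjoint_Sets"
begin

text \<open>
  The finite point set \<open>\<Omega>\<close> is the universe of a type \<open>'a::finite\<close>, so that \<open>M\<^sub>\<Omega>(\<real>)\<close> is
  \<open>real^'a^'a\<close>. In the notation of the definitions below, \<open>R(\<alpha>)\<close> is \<open>R `` {\<alpha>}\<close> and
  \<open>1\<^sub>\<Omega>\<close> is \<open>Id\<close>.
\<close>

definition adjacency_matrix :: "('a::finite \<times> 'a) set \<Rightarrow> real^'a^'a" where
  "adjacency_matrix R = (\<chi> \<alpha> \<beta>. if (\<alpha>, \<beta>) \<in> R then 1 else 0)"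

definition rainbow :: "('a::finite \<times> 'a) set set \<Rightarrow> bool" where
  "rainbow \<C> \<longleftrightarrow>
     partition_on UNIV \<C> \<and> (\<exists>\<D>\<subseteq>\<C>. Id = \<Union>\<D>) \<and> (\<forall>R\<in>\<C>. R\<inverse> \<in> \<C>)"

definition coherent_configuration :: "('a::finite \<times> 'a) set set \<Rightarrow> bool" where
  "coherent_configuration \<C> \<longleftrightarrow> rainbow \<C> \<and>
     (\<forall>C\<in>\<C>. \<forall>D\<in>\<C>. \<forall>R\<in>\<C>. \<forall>(\<alpha>, \<beta>)\<in>R. \<forall>(\<alpha>', \<beta>')\<in>R.
        card (C `` {\<alpha>} \<inter> D\<inverse> `` {\<beta>}) = card (C `` {\<alpha>'} \<inter> D\<inverse> `` {\<beta>'}))"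

definition association_scheme :: "('a::finite \<times> 'a) set set \<Rightarrow> bool" where
  "association_scheme \<C> \<longleftrightarrow> coherent_configuration \<C> \<and> Id \<in> \<C>"

definition jordan_configuration :: "('a::finite \<times> 'a) set set \<Rightarrow> bool" where
  "jordan_configuration \<C> \<longleftrightarrow> rainbow \<C> \<and>
     (\<forall>C\<in>\<C>. \<forall>D\<in>\<C>. \<forall>R\<in>\<C>. \<forall>(\<alpha>, \<beta>)\<in>R. \<forall>(\<alpha>', \<beta>')\<in>R.
        card (C `` {\<alpha>} \<inter> D\<inverse> `` {\<beta>}) + card (D `` {\<alpha>} \<inter> C\<inverse> `` {\<beta>})
        = card (C `` {\<alpha>'} \<inter> D\<inverse> `` {\<beta>'}) + card (D `` {\<alpha>'} \<inter> C\<inverse> `` {\<beta>'}))"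

definition jordan_scheme :: "('a::finite \<times> 'a) set set \<Rightarrow> bool" where
  "jordan_scheme \<C> \<longleftrightarrow> jordan_configuration \<C> \<and> Id \<in> \<C>"

text \<open>
  On \<open>real^'a^'a\<close>, \<open>**\<close> is the matrix product and \<open>*\<close> the entrywise product;
  \<open>mat 1\<close> is the identity matrix.
\<close>

definition coherent_algebra :: "(real^'a^'a::finite) set \<Rightarrow> bool" where
  "coherent_algebra \<A> \<longleftrightarrow>
     subspace \<A> \<and> mat 1 \<in> \<A> \<and> (\<chi> \<alpha> \<beta>. 1) \<in> \<A> \<and>
     (\<forall>A\<in>\<A>. transpose A \<in> \<A>) \<and>
     (\<forall>A\<in>\<A>. \<forall>B\<in>\<A>. A ** B \<in> \<A>) \<and>
     (\<forall>A\<in>\<A>. \<forall>B\<in>\<A>. A * B \<in> \<A>)"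

definition symmetrization :: "(real^'a^'a::finite) set \<Rightarrow> (real^'a^'a) set" where
  "symmetrization \<A> = {A \<in> \<A>. transpose A = A}"

definition proper_jordan_configuration :: "('a::finite \<times> 'a) set set \<Rightarrow> bool" where
  "proper_jordan_configuration \<C> \<longleftrightarrow> jordan_configuration \<C> \<and>
     \<not> (\<exists>\<A>. coherent_algebra \<A> \<and> span (adjacency_matrix ` \<C>) = symmetrization \<A>)"

end

theory Submission
  imports Defs
begin

text \<open>
  The algebra relations force each \<open>C\<^sub>i\<close> to be a permutation and each \<open>S\<^sub>i\<close> to be symmetric of
  valency \<open>n\<close>. Write \<open>e\<close> for the diagonal projection onto \<open>\<Omega>\<^sub>1\<close>, which commutes with all \<open>C\<^sub>i\<close>.
  The matrices satisfy \<open>C\<^sub>i T\<^sub>j + T\<^sub>j C\<^sub>i = T\<^sub>i\<^sub>+\<^sub>j + T\<^sub>j\<^sub>-\<^sub>i\<close> and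
  \<open>T\<^sub>i T\<^sub>j + T\<^sub>j T\<^sub>i = n (C\<^sub>i\<^sub>-\<^sub>j + C\<^sub>j\<^sub>-\<^sub>i) + 2 (n - 1) / m \<cdot> \<Sum>\<^sub>k T\<^sub>k\<close>: on the block
  \<open>\<Omega>\<^sub>2 \<times> \<Omega>\<^sub>2\<close> the extra terms \<open>S\<^sub>i e S\<^sub>j - S\<^sub>-\<^sub>i e S\<^sub>-\<^sub>j\<close> cancel after symmetrization because
  \<open>S\<^sub>i e S\<^sub>j = S\<^sub>-\<^sub>j e S\<^sub>-\<^sub>i\<close>. Hence the linear span is closed under the Jordan product.

  If the span were the symmetrization of a coherent algebra, that algebra would contain the
  entrywise product \<open>Y\<close> of \<open>T\<^sub>1 T\<^sub>0\<close> and \<open>D\<^sub>1\<close>, which is \<open>n C\<^sub>1\<close> on \<open>\<Omega>\<^sub>1\<close> and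
  \<open>C\<^sub>1 + (n - 1) C\<^sub>-\<^sub>1\<close> on \<open>\<Omega>\<^sub>2\<close>. The symmetric matrix \<open>Y Y\<^sup>T\<close> would then lie in the span, but its
  diagonal takes the values \<open>n\<^sup>2\<close> on \<open>\<Omega>\<^sub>1\<close> and \<open>1 + (n - 1)\<^sup>2\<close> on \<open>\<Omega>\<^sub>2\<close>, distinct for \<open>n \<ge> 2\<close>.
\<close>

section \<open>Adjacency matrices, intersection numbers and spans\<close>

lemma adjacency_matrix_nth: "adjacency_matrix R $ \<alpha> $ \<beta> = of_bool ((\<alpha>, \<beta>) \<in> R)"
  by (simp add: adjacency_matrix_def)

lemma matrix_matrix_mult_nth: "(A ** B) $ i $ j = (\<Sum>k\<in>UNIV. A $ i $ k * B $ k $ j)"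
  by (simp add: matrix_matrix_mult_def)

lemma adjacency_matrix_mult_nth:
  "(adjacency_matrix R ** adjacency_matrix R') $ \<alpha> $ \<beta> = real (card (R `` {\<alpha>} \<inter> R'\<inverse> `` {\<beta>}))"
proof -
  have "(adjacency_matrix R ** adjacency_matrix R') $ \<alpha> $ \<beta>
      = (\<Sum>\<gamma>\<in>UNIV. of_bool (\<gamma> \<in> R `` {\<alpha>} \<inter> R'\<inverse> `` {\<beta>}))"
    unfolding matrix_matrix_mult_nth adjacency_matrix_nth by (intro sum.cong) auto
  then show ?thesis
    by (simp add: sum.If_cases of_bool_def Int_def)
qed

lemma card_Image_singleton:
  fixes R :: "('a::finite \<times> 'a) set"
  shows "real (card (R `` {\<alpha>})) = (\<Sum>\<beta>\<in>UNIV. adjacency_matrix R $ \<alpha> $ \<beta>)"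
  by (simp add: adjacency_matrix_nth of_bool_def sum.If_cases Image_def)

text \<open>All diagonal pairs lie in the single class \<open>Id\<close>, and the intersection
  number of \<open>R\<close> and its transpose at such a pair is the valency.\<close>

lemma association_scheme_valency:
  assumes "association_scheme \<C>" and "R \<in> \<C>"
  shows "card (R `` {\<alpha>}) = card (R `` {\<beta>})"
proof -
  have cc: "coherent_configuration \<C>" and Id: "Id \<in> \<C>"
    using assms(1) by (auto simp: association_scheme_def)
  moreover have "R\<inverse> \<in> \<C>"
    using cc assms(2) by (auto simp: coherent_configuration_def rainbow_def)
  ultimately have "card (R `` {\<alpha>} \<inter> (R\<inverse>)\<inverse> `` {\<alpha>}) = card (R `` {\<beta>} \<inter> (R\<inverse>)\<inverse> `` {\<beta>})"
    using assms(2) unfolding coherent_configuration_def by blast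
  then show ?thesis by simp
qed

text \<open>The classes are disjoint, so every generator is constant on \<open>R\<close>, and linear
  combinations inherit this.\<close>

lemma span_adjacency_matrix_const:
  assumes "partition_on UNIV \<C>" and "M \<in> span (adjacency_matrix ` \<C>)"
    and "R \<in> \<C>" and "(\<alpha>, \<beta>) \<in> R" and "(\<alpha>', \<beta>') \<in> R"
  shows "M $ \<alpha> $ \<beta> = M $ \<alpha>' $ \<beta>'"
  using assms(2)
proof (induction rule: span_induct_alt)
  case (step c x y)
  then obtain R' where R': "R' \<in> \<C>" "x = adjacency_matrix R'" by auto
  have "R = R' \<or> R \<inter> R' = {}"
    using assms(1,3) R'(1) by (auto simp: partition_on_def disjoint_def)
  then have "(\<alpha>, \<beta>) \<in> R' \<longleftrightarrow> (\<alpha>', \<beta>') \<in> R'" using assms(4,5) by auto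
  then show ?case using step by (simp add: R' adjacency_matrix_nth)
qed simp

lemma matrix_add_rdistrib: "(A + B) ** C = A ** C + B ** C" for A B C :: "real^'a^'a"
  by (simp add: vec_eq_iff matrix_matrix_mult_nth distrib_right sum.distrib)

text \<open>The \<open>(\<alpha>, \<beta>)\<close> entry of a Jordan product is the sum of the two
  intersection numbers in the definition, so the counting condition follows from closure of the
  span.\<close>

lemma jordan_configuration_spanI:
  assumes "rainbow \<C>"
    and "\<And>R R'. R \<in> \<C> \<Longrightarrow> R' \<in> \<C> \<Longrightarrow>
      adjacency_matrix R ** adjacency_matrix R' + adjacency_matrix R' ** adjacency_matrix R
        \<in> span (adjacency_matrix ` \<C>)"
  shows "jordan_configuration \<C>"
proof -
  have p: "partition_on UNIV \<C>" using assms(1) by (simp add: rainbow_def)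
  have "card (A `` {\<alpha>} \<inter> B\<inverse> `` {\<beta>}) + card (B `` {\<alpha>} \<inter> A\<inverse> `` {\<beta>})
      = card (A `` {\<alpha>'} \<inter> B\<inverse> `` {\<beta>'}) + card (B `` {\<alpha>'} \<inter> A\<inverse> `` {\<beta>'})"
    if "A \<in> \<C>" "B \<in> \<C>" "R \<in> \<C>" "(\<alpha>, \<beta>) \<in> R" "(\<alpha>', \<beta>') \<in> R" for A B R \<alpha> \<beta> \<alpha>' \<beta>'
  proof -
    have "real (card (A `` {\<alpha>} \<inter> B\<inverse> `` {\<beta>}) + card (B `` {\<alpha>} \<inter> A\<inverse> `` {\<beta>}))
      = real (card (A `` {\<alpha>'} \<inter> B\<inverse> `` {\<beta>'}) + card (B `` {\<alpha>'} \<inter> A\<inverse> `` {\<beta>'}))"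
      using span_adjacency_matrix_const[OF p assms(2)[OF that(1,2)] that(3-5)]
      by (simp only: vector_add_component adjacency_matrix_mult_nth of_nat_add)
    then show ?thesis by (simp only: of_nat_eq_iff)
  qed
  with assms(1) show ?thesis unfolding jordan_configuration_def by blast
qed

section \<open>Permutations, valencies and symmetry from the algebra relations\<close>

text \<open>Both families are indexed periodically by all integers, so index arithmetic modulo
  \<open>m\<close> needs no explicit reduction.\<close>

locale dihedral_scheme =
  fixes m n :: nat and C S :: "int \<Rightarrow> ('a::finite \<times> 'a) set"
  assumes m_pos: "m > 0" and n_pos: "n > 0"
    and C_mod: "C (i mod int m) = C i" and S_mod: "S (i mod int m) = S i"
    and scheme: "association_scheme (range C \<union> range S)"
    and order: "CARD('a) = m * (n + 1)"
    and C_0: "C 0 = Id"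
    and C_C: "adjacency_matrix (C i) ** adjacency_matrix (C j) = adjacency_matrix (C (i + j))"
    and C_S: "adjacency_matrix (C i) ** adjacency_matrix (S j) = adjacency_matrix (S (i + j))"
    and S_C: "adjacency_matrix (S j) ** adjacency_matrix (C i) = adjacency_matrix (S (j - i))"
    and S_S: "adjacency_matrix (S i) ** adjacency_matrix (S j)
      = real n *\<^sub>R adjacency_matrix (C (i - j))
        + ((real n - 1) / real m) *\<^sub>R (\<Sum>k\<in>{0..<int m}. adjacency_matrix (S k))"
begin

abbreviation c where "c i \<equiv> adjacency_matrix (C i)"
abbreviation s where "s i \<equiv> adjacency_matrix (S i)"

lemma S_S_nth: "(s i ** s j) $ \<alpha> $ \<beta> = real n * c (i - j) $ \<alpha> $ \<beta>
    + (real n - 1) / real m * (\<Sum>k\<in>{0..<int m}. s k $ \<alpha> $ \<beta>)"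
  by (simp add: S_S)

lemma C_or_S: obtains k where "(\<alpha>, \<beta>) \<in> C k \<or> (\<alpha>, \<beta>) \<in> S k"
proof -
  have "\<Union> (range C \<union> range S) = UNIV"
    using scheme
    by (simp add: association_scheme_def coherent_configuration_def rainbow_def partition_on_def)
  then have "(\<alpha>, \<beta>) \<in> \<Union> (range C \<union> range S)" by simp
  then show ?thesis using that by auto
qed

lemma C_comp: "(\<alpha>, \<beta>) \<in> C i \<Longrightarrow> (\<beta>, \<gamma>) \<in> C j \<Longrightarrow> (\<alpha>, \<gamma>) \<in> C (i + j)"
proof (rule ccontr)
  assume ab: "(\<alpha>, \<beta>) \<in> C i" and bg: "(\<beta>, \<gamma>) \<in> C j" and "(\<alpha>, \<gamma>) \<notin> C (i + j)"
  then have "(c i ** c j) $ \<alpha> $ \<gamma> = 0" by (simp add: C_C adjacency_matrix_nth)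
  then have "C i `` {\<alpha>} \<inter> (C j)\<inverse> `` {\<gamma>} = {}"
    unfolding adjacency_matrix_mult_nth by simp
  then show False using ab bg by auto
qed

text \<open>The product of \<open>c i\<close> and \<open>c (- i)\<close> is the identity matrix,
  whose diagonal entry 1 counts an intermediate point.\<close>

lemma C_total: obtains \<beta> where "(\<alpha>, \<beta>) \<in> C i" "(\<beta>, \<alpha>) \<in> C (- i)"
proof -
  have "(c i ** c (- i)) $ \<alpha> $ \<alpha> = 1" by (simp add: C_C C_0 adjacency_matrix_nth)
  then have "C i `` {\<alpha>} \<inter> (C (- i))\<inverse> `` {\<alpha>} \<noteq> {}"
    unfolding adjacency_matrix_mult_nth by auto
  then show ?thesis using that by auto
qed

text \<open>Prefixing a step in \<open>C (- i)\<close> moves both pairs into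
  \<open>C 0 = Id\<close>.\<close>

lemma C_functional: "(\<alpha>, \<beta>) \<in> C i \<Longrightarrow> (\<alpha>, \<gamma>) \<in> C i \<Longrightarrow> \<beta> = \<gamma>"
proof -
  assume b: "(\<alpha>, \<beta>) \<in> C i" and g: "(\<alpha>, \<gamma>) \<in> C i"
  obtain \<delta> where "(\<delta>, \<alpha>) \<in> C (- i)" using C_total by blast
  then have "(\<delta>, \<beta>) \<in> C 0" "(\<delta>, \<gamma>) \<in> C 0" using C_comp[of \<delta> \<alpha> "- i"] b g by force+
  then show ?thesis by (simp add: C_0)
qed

lemma C_uminus_iff: "(\<alpha>, \<beta>) \<in> C (- i) \<longleftrightarrow> (\<beta>, \<alpha>) \<in> C i"
proof -
  have "(\<beta>, \<alpha>) \<in> C (- i)" if "(\<alpha>, \<beta>) \<in> C i" for \<alpha> \<beta> i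
    using that C_total[of \<alpha> i] C_functional by metis
  from this[of \<alpha> \<beta> "- i"] this[of \<beta> \<alpha> i] show ?thesis by auto
qed

lemma sum_c: "(\<Sum>\<beta>\<in>UNIV. c i $ \<alpha> $ \<beta>) = 1"
proof -
  obtain \<beta> where b: "(\<alpha>, \<beta>) \<in> C i" using C_total by blast
  then have "C i `` {\<alpha>} = {\<beta>}" using C_functional by auto
  then show ?thesis by (simp flip: card_Image_singleton)
qed

lemma C_mult_nth:
  assumes "(\<alpha>, \<beta>) \<in> C i"
  shows "(c i ** M) $ \<alpha> $ \<gamma> = M $ \<beta> $ \<gamma>"
proof -
  have "(\<alpha>, \<delta>) \<in> C i \<longleftrightarrow> \<delta> = \<beta>" for \<delta> using assms C_functional by auto
  then show ?thesis by (simp add: matrix_matrix_mult_nth adjacency_matrix_nth)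
qed

lemma mult_C_nth:
  assumes "(\<beta>, \<gamma>) \<in> C i"
  shows "(M ** c i) $ \<alpha> $ \<gamma> = M $ \<alpha> $ \<beta>"
proof -
  have "(\<delta>, \<gamma>) \<in> C i \<longleftrightarrow> \<delta> = \<beta>" for \<delta>
    using assms C_functional[of \<gamma> _ "- i"] by (auto simp: C_uminus_iff)
  then show ?thesis by (simp add: matrix_matrix_mult_nth adjacency_matrix_nth)
qed

lemma sum_mult: "(\<Sum>\<beta>\<in>UNIV. (M ** N) $ \<alpha> $ \<beta>) = (\<Sum>\<gamma>\<in>UNIV. M $ \<alpha> $ \<gamma> * (\<Sum>\<beta>\<in>UNIV. N $ \<gamma> $ \<beta>))"
  for M N :: "real^'a^'a"
  unfolding matrix_matrix_mult_nth sum_distrib_left by (rule sum.swap)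

text \<open>Right multiplication by a permutation \<open>c (- j)\<close> turns \<open>s 0\<close>
  into \<open>s j\<close>, so all row sums share one value \<open>r\<close>. Row sums in the
  relation for \<open>s 0 ** s 0\<close> give a quadratic equation for \<open>r\<close>.\<close>

lemma sum_s: "(\<Sum>\<beta>\<in>UNIV. s i $ \<alpha> $ \<beta>) = real n"
proof -
  define r where "r = (\<Sum>\<beta>\<in>UNIV. s 0 $ \<alpha> $ \<beta>)"
  have s_r: "(\<Sum>\<beta>\<in>UNIV. s j $ \<gamma> $ \<beta>) = r" for j \<gamma>
  proof -
    have "(\<Sum>\<beta>\<in>UNIV. s j $ \<gamma> $ \<beta>) = (\<Sum>\<beta>\<in>UNIV. s 0 $ \<gamma> $ \<beta>)"
      using sum_mult[of "s 0" "c (- j)" \<gamma>] by (simp add: S_C sum_c)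
    also have "\<dots> = r"
      unfolding r_def card_Image_singleton[symmetric]
      using association_scheme_valency[OF scheme, of "S 0"] by (metis UnI2 rangeI)
    finally show ?thesis .
  qed
  have "r * r = (\<Sum>\<beta>\<in>UNIV. (s 0 ** s 0) $ \<alpha> $ \<beta>)"
    by (simp only: sum_mult s_r flip: sum_distrib_right)
  also have "\<dots> = real n + (real n - 1) / real m * (\<Sum>\<beta>\<in>UNIV. \<Sum>k\<in>{0..<int m}. s k $ \<alpha> $ \<beta>)"
    unfolding S_S_nth sum.distrib sum_distrib_left[symmetric] by (simp add: sum_c)
  also have "(\<Sum>\<beta>\<in>UNIV. \<Sum>k\<in>{0..<int m}. s k $ \<alpha> $ \<beta>) = real m * r"
    by (subst sum.swap) (simp add: s_r)
  also have "(real n - 1) / real m * (real m * r) = (real n - 1) * r" using m_pos by simp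
  \<comment> \<open>The quadratic has roots \<open>n\<close> and \<open>-1\<close>; a row sum of a
    0-1 matrix excludes the latter.\<close>
  finally have "(r - real n) * (r + 1) = 0" by (simp add: algebra_simps)
  moreover have "r \<ge> 0" by (simp add: r_def adjacency_matrix_nth sum_nonneg)
  ultimately show ?thesis using s_r by auto
qed

lemma mod_mem [simp]: "i mod int m \<in> {0..<int m}" using m_pos by simp

text \<open>
  The classes cover \<open>\<Omega>\<^sup>2\<close> and their valencies add up to \<open>m + m n = |\<Omega>|\<close>, so no pair lies in
  two of them; in particular the relations \<open>C k\<close>, \<open>S k\<close> with \<open>0 \<le> k < m\<close> are pairwise distinct.
\<close>
lemma sum_all: "(\<Sum>k\<in>{0..<int m}. c k $ \<alpha> $ \<beta>) + (\<Sum>k\<in>{0..<int m}. s k $ \<alpha> $ \<beta>) = 1"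
proof -
  define N where "N \<beta> = (\<Sum>k\<in>{0..<int m}. c k $ \<alpha> $ \<beta>) + (\<Sum>k\<in>{0..<int m}. s k $ \<alpha> $ \<beta>)" for \<beta>
  have ge: "N \<beta> \<ge> 1" for \<beta>
  proof -
    obtain k where "(\<alpha>, \<beta>) \<in> C k \<or> (\<alpha>, \<beta>) \<in> S k" using C_or_S by blast
    then have "c (k mod int m) $ \<alpha> $ \<beta> = 1 \<or> s (k mod int m) $ \<alpha> $ \<beta> = 1"
      by (auto simp: adjacency_matrix_nth C_mod S_mod)
    moreover have "c (k mod int m) $ \<alpha> $ \<beta> \<le> (\<Sum>k\<in>{0..<int m}. c k $ \<alpha> $ \<beta>)"
      "s (k mod int m) $ \<alpha> $ \<beta> \<le> (\<Sum>k\<in>{0..<int m}. s k $ \<alpha> $ \<beta>)"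
      by (rule member_le_sum[OF mod_mem]; simp add: adjacency_matrix_nth)+
    moreover have "0 \<le> (\<Sum>k\<in>{0..<int m}. c k $ \<alpha> $ \<beta>)" "0 \<le> (\<Sum>k\<in>{0..<int m}. s k $ \<alpha> $ \<beta>)"
      by (simp_all add: adjacency_matrix_nth sum_nonneg)
    ultimately show ?thesis by (auto simp: N_def)
  qed
  have "(\<Sum>\<beta>\<in>UNIV. N \<beta>) = real (m * (n + 1))"
    unfolding N_def sum.distrib
    by (subst (1 2) sum.swap) (simp add: sum_c sum_s algebra_simps)
  then have "(\<Sum>\<beta>\<in>UNIV. N \<beta> - 1) = 0"
    by (simp add: sum_subtractf order)
  then have "N \<beta> - 1 = 0"
    using ge by (subst (asm) sum_nonneg_eq_0_iff) auto
  then show ?thesis by (simp add: N_def)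
qed

lemma C_S_disjoint: "(\<alpha>, \<beta>) \<in> C i \<Longrightarrow> (\<alpha>, \<beta>) \<notin> S j"
proof
  assume "(\<alpha>, \<beta>) \<in> C i" "(\<alpha>, \<beta>) \<in> S j"
  then have "c (i mod int m) $ \<alpha> $ \<beta> = 1" "s (j mod int m) $ \<alpha> $ \<beta> = 1"
    by (simp_all add: adjacency_matrix_nth C_mod S_mod)
  moreover have "c (i mod int m) $ \<alpha> $ \<beta> \<le> (\<Sum>k\<in>{0..<int m}. c k $ \<alpha> $ \<beta>)"
    "s (j mod int m) $ \<alpha> $ \<beta> \<le> (\<Sum>k\<in>{0..<int m}. s k $ \<alpha> $ \<beta>)"
    by (rule member_le_sum[OF mod_mem]; simp add: adjacency_matrix_nth)+
  ultimately show False using sum_all[of \<alpha> \<beta>] by simp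
qed

text \<open>Two distinct residues would already contribute 2 to the sum.\<close>

lemma sum_le_1_unique:
  fixes f :: "int \<Rightarrow> real"
  assumes "(\<Sum>k\<in>{0..<int m}. f k) \<le> 1" and "\<And>k. f k \<ge> 0"
    and "f (i mod int m) = 1" and "f (j mod int m) = 1"
  shows "i mod int m = j mod int m"
proof (rule ccontr)
  assume "i mod int m \<noteq> j mod int m"
  then have "2 = (\<Sum>k\<in>{i mod int m, j mod int m}. f k)" using assms by simp
  also have "\<dots> \<le> (\<Sum>k\<in>{0..<int m}. f k)"
    by (rule sum_mono2) (use assms m_pos in auto)
  finally show False using assms by simp
qed

lemma C_unique:
  assumes "(\<alpha>, \<beta>) \<in> C i" "(\<alpha>, \<beta>) \<in> C j" shows "i mod int m = j mod int m"
proof (rule sum_le_1_unique)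
  have "0 \<le> (\<Sum>k\<in>{0..<int m}. s k $ \<alpha> $ \<beta>)" by (simp add: adjacency_matrix_nth sum_nonneg)
  then show "(\<Sum>k\<in>{0..<int m}. c k $ \<alpha> $ \<beta>) \<le> 1" using sum_all[of \<alpha> \<beta>] by simp
qed (use assms in \<open>simp_all add: adjacency_matrix_nth C_mod\<close>)

lemma S_unique:
  assumes "(\<alpha>, \<beta>) \<in> S i" "(\<alpha>, \<beta>) \<in> S j" shows "i mod int m = j mod int m"
proof (rule sum_le_1_unique)
  have "0 \<le> (\<Sum>k\<in>{0..<int m}. c k $ \<alpha> $ \<beta>)" by (simp add: adjacency_matrix_nth sum_nonneg)
  then show "(\<Sum>k\<in>{0..<int m}. s k $ \<alpha> $ \<beta>) \<le> 1" using sum_all[of \<alpha> \<beta>] by simp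
qed (use assms in \<open>simp_all add: adjacency_matrix_nth S_mod\<close>)

lemma C_cong: "i mod int m = j mod int m \<Longrightarrow> C i = C j"
  by (metis C_mod)

lemma S_cong: "i mod int m = j mod int m \<Longrightarrow> S i = S j"
  by (metis S_mod)

lemma sum_s_C:
  assumes "(\<alpha>, \<beta>) \<in> C i" shows "(\<Sum>k\<in>{0..<int m}. s k $ \<alpha> $ \<beta>) = 0"
  using C_S_disjoint[OF assms] by (simp add: adjacency_matrix_nth)

text \<open>
  The diagonal entry of \<open>s i ** s i\<close> counts the \<open>\<beta>\<close> joined to \<open>\<alpha>\<close> in both directions,
  and it attains the valency \<open>n\<close>.
\<close>
lemma S_sym: "(\<alpha>, \<beta>) \<in> S i \<longleftrightarrow> (\<beta>, \<alpha>) \<in> S i"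
proof -
  have "(\<beta>, \<alpha>) \<in> S i" if ab: "(\<alpha>, \<beta>) \<in> S i" for \<alpha> \<beta>
  proof -
    have "(s i ** s i) $ \<alpha> $ \<alpha> = real n"
      using sum_s_C[of \<alpha> \<alpha> 0] by (simp add: S_S_nth C_0 adjacency_matrix_nth)
    then have "(\<Sum>\<gamma>\<in>UNIV. s i $ \<alpha> $ \<gamma> - s i $ \<alpha> $ \<gamma> * s i $ \<gamma> $ \<alpha>) = 0"
      by (simp add: sum_subtractf sum_s matrix_matrix_mult_nth)
    then have "s i $ \<alpha> $ \<beta> - s i $ \<alpha> $ \<beta> * s i $ \<beta> $ \<alpha> = 0"
      by (subst (asm) sum_nonneg_eq_0_iff) (auto simp: adjacency_matrix_nth)
    then show ?thesis using ab by (simp add: adjacency_matrix_nth split: if_splits)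
  qed
  then show ?thesis by blast
qed

lemma S_total: obtains \<beta> where "(\<alpha>, \<beta>) \<in> S i"
proof -
  have "real (card (S i `` {\<alpha>})) = real n" unfolding card_Image_singleton by (rule sum_s)
  then have "S i `` {\<alpha>} \<noteq> {}" using n_pos by auto
  then show ?thesis using that by auto
qed

text \<open>Reflection of the index is an involution of the residues modulo
  \<open>m\<close>.\<close>

lemma sum_reflect:
  assumes "\<And>k. f (k mod int m) = f k"
  shows "(\<Sum>k\<in>{0..<int m}. f (j - k)) = (\<Sum>k\<in>{0..<int m}. f k :: real)"
  by (rule sum.reindex_bij_witness[where i = "\<lambda>k. (j - k) mod int m" and j = "\<lambda>k. (j - k) mod int m"])
    (use m_pos in \<open>auto simp: mod_diff_right_eq assms\<close>)

end

section \<open>The switched relations\<close>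

locale switched_dihedral_scheme = dihedral_scheme +
  fixes \<Omega>1 :: "'a set"
  assumes \<Omega>1: "\<Omega>1 \<in> UNIV // (\<Union>i. C i)"
begin

definition D :: "int \<Rightarrow> ('a \<times> 'a) set" where
  "D i = C i \<union> C (- i)"

text \<open>No pair inside \<open>\<Omega>1\<close> lies in any \<open>S k\<close>, so asking for
  one end in \<open>\<Omega>1\<close> selects exactly the part of \<open>S i\<close> between
  \<open>\<Omega>1\<close> and its complement.\<close>

definition T :: "int \<Rightarrow> ('a \<times> 'a) set" where
  "T i = {(\<alpha>, \<beta>). (\<alpha>, \<beta>) \<in> S (if \<alpha> \<in> \<Omega>1 \<or> \<beta> \<in> \<Omega>1 then i else - i)}"

abbreviation classes where "classes \<equiv> range D \<union> range T"
abbreviation t where "t i \<equiv> adjacency_matrix (T i)"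
abbreviation e where "e \<equiv> adjacency_matrix (Id_on \<Omega>1)"

lemma \<Omega>1_base: obtains \<omega> where "\<And>\<alpha>. \<alpha> \<in> \<Omega>1 \<longleftrightarrow> (\<exists>i. (\<omega>, \<alpha>) \<in> C i)"
  using \<Omega>1 by (auto elim!: quotientE)

lemma C_\<Omega>1: "(\<alpha>, \<beta>) \<in> C i \<Longrightarrow> \<alpha> \<in> \<Omega>1 \<longleftrightarrow> \<beta> \<in> \<Omega>1"
  using \<Omega>1_base C_comp C_uminus_iff by metis

lemma \<Omega>1_C:
  assumes "\<alpha> \<in> \<Omega>1" "\<beta> \<in> \<Omega>1"
  obtains i where "(\<alpha>, \<beta>) \<in> C i"
  using assms \<Omega>1_base C_comp C_uminus_iff by metis

lemma \<Omega>1_not_S: "\<alpha> \<in> \<Omega>1 \<Longrightarrow> \<beta> \<in> \<Omega>1 \<Longrightarrow> (\<alpha>, \<beta>) \<notin> S i"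
  using \<Omega>1_C C_S_disjoint by metis

lemma t_nth: "t i $ \<alpha> $ \<beta> = s (if \<alpha> \<in> \<Omega>1 \<or> \<beta> \<in> \<Omega>1 then i else - i) $ \<alpha> $ \<beta>"
  by (simp add: adjacency_matrix_nth T_def)

lemma S_\<Omega>1_S_nth: "(s i ** e ** s j) $ \<alpha> $ \<beta> = (\<Sum>\<gamma>\<in>\<Omega>1. s i $ \<alpha> $ \<gamma> * s j $ \<gamma> $ \<beta>)"
proof -
  have "(s i ** e) $ \<alpha> $ \<gamma> = s i $ \<alpha> $ \<gamma> * of_bool (\<gamma> \<in> \<Omega>1)" for \<gamma>
  proof -
    have "(\<delta>, \<gamma>) \<in> Id_on \<Omega>1 \<longleftrightarrow> \<gamma> \<in> \<Omega>1 \<and> \<delta> = \<gamma>" for \<delta> by auto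
    then show ?thesis
      by (cases "\<gamma> \<in> \<Omega>1") (simp_all add: matrix_matrix_mult_nth adjacency_matrix_nth[of "Id_on \<Omega>1"])
  qed
  then have "(s i ** e ** s j) $ \<alpha> $ \<beta>
      = (\<Sum>\<gamma>\<in>UNIV. if \<gamma> \<in> \<Omega>1 then s i $ \<alpha> $ \<gamma> * s j $ \<gamma> $ \<beta> else 0)"
    unfolding matrix_matrix_mult_nth[of "s i ** e"] by (intro sum.cong) auto
  then show ?thesis by (simp add: sum.If_cases)
qed

text \<open>The permutation \<open>C i\<close> maps \<open>\<Omega>1\<close> to itself.\<close>

lemma C_\<Omega>1_commute: "c i ** e = e ** c i"
proof -
  have "C i `` {\<alpha>} \<inter> (Id_on \<Omega>1)\<inverse> `` {\<beta>} = (if \<alpha> \<in> \<Omega>1 \<and> (\<alpha>, \<beta>) \<in> C i then {\<beta>} else {})"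
    "Id_on \<Omega>1 `` {\<alpha>} \<inter> (C i)\<inverse> `` {\<beta>} = (if \<alpha> \<in> \<Omega>1 \<and> (\<alpha>, \<beta>) \<in> C i then {\<alpha>} else {})" for \<alpha> \<beta>
    using C_\<Omega>1 by auto
  then show ?thesis
    unfolding vec_eq_iff adjacency_matrix_mult_nth by simp
qed

text \<open>The symmetry that makes the contributions of \<open>\<Omega>1\<close> to the block \<open>\<Omega>2 \<times> \<Omega>2\<close> of the Jordan
  product of \<open>t i\<close> and \<open>t j\<close> cancel.\<close>
lemma S_\<Omega>1_S: "s i ** e ** s j = s (- j) ** e ** s (- i)"
proof -
  have "s i ** e ** s j = s (- j) ** c (- j - i) ** e ** s j"
    by (simp add: S_C)
  also have "\<dots> = s (- j) ** e ** (c (- j - i) ** s j)"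
    using C_\<Omega>1_commute[of "- j - i"] by (metis matrix_mul_assoc)
  also have "\<dots> = s (- j) ** e ** s (- i)"
    by (simp add: C_S)
  finally show ?thesis .
qed

section \<open>Jordan products of the switched matrices\<close>

text \<open>If an end lies in \<open>\<Omega>1\<close>, only middle points outside
  \<open>\<Omega>1\<close> contribute. Otherwise middle points in \<open>\<Omega>1\<close> use the
  indices \<open>i\<close>, \<open>j\<close> in place of \<open>- i\<close>, \<open>- j\<close>,
  which the two terms with \<open>e\<close> correct.\<close>

lemma T_T_nth:
  "(t i ** t j) $ \<alpha> $ \<beta> =
     (if \<alpha> \<in> \<Omega>1 then (s i ** s (if \<beta> \<in> \<Omega>1 then j else - j)) $ \<alpha> $ \<beta>
      else if \<beta> \<in> \<Omega>1 then (s (- i) ** s j) $ \<alpha> $ \<beta>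
      else (s (- i) ** s (- j)) $ \<alpha> $ \<beta> + (s i ** e ** s j) $ \<alpha> $ \<beta>
        - (s (- i) ** e ** s (- j)) $ \<alpha> $ \<beta>)"
proof -
  have z: "s k $ \<gamma> $ \<delta> = 0" if "\<gamma> \<in> \<Omega>1" "\<delta> \<in> \<Omega>1" for k \<gamma> \<delta>
    using \<Omega>1_not_S[OF that] by (simp add: adjacency_matrix_nth)
  show ?thesis
  proof (cases "\<alpha> \<in> \<Omega>1 \<or> \<beta> \<in> \<Omega>1")
    case True
    then show ?thesis
      by (auto simp: matrix_matrix_mult_nth t_nth z intro!: sum.cong)
  next
    case False
    have "(t i ** t j) $ \<alpha> $ \<beta> = (\<Sum>\<gamma>\<in>UNIV. s (- i) $ \<alpha> $ \<gamma> * s (- j) $ \<gamma> $ \<beta>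
        + (if \<gamma> \<in> \<Omega>1 then s i $ \<alpha> $ \<gamma> * s j $ \<gamma> $ \<beta> else 0)
        - (if \<gamma> \<in> \<Omega>1 then s (- i) $ \<alpha> $ \<gamma> * s (- j) $ \<gamma> $ \<beta> else 0))"
      unfolding matrix_matrix_mult_nth using False by (intro sum.cong) (auto simp: t_nth)
    then show ?thesis
      using False
      by (simp add: S_\<Omega>1_S_nth sum.distrib sum_subtractf matrix_matrix_mult_nth[of "s (- i)"]
        sum.If_cases del: sum.inter_restrict)
  qed
qed

lemma sum_t: "(\<Sum>k\<in>{0..<int m}. t k $ \<alpha> $ \<beta>) = (\<Sum>k\<in>{0..<int m}. s k $ \<alpha> $ \<beta>)"
  using sum_reflect[of "\<lambda>k. s k $ \<alpha> $ \<beta>" 0] by (cases "\<alpha> \<in> \<Omega>1 \<or> \<beta> \<in> \<Omega>1") (simp_all add: t_nth S_mod)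

lemma T_jordan_T:
  "t i ** t j + t j ** t i = real n *\<^sub>R (c (i - j) + c (- (i - j)))
     + (2 * (real n - 1) / real m) *\<^sub>R (\<Sum>k\<in>{0..<int m}. t k)"
proof -
  have "(t i ** t j) $ \<alpha> $ \<beta> + (t j ** t i) $ \<alpha> $ \<beta> =
      real n * (c (i - j) $ \<alpha> $ \<beta> + c (- (i - j)) $ \<alpha> $ \<beta>)
        + 2 * (real n - 1) / real m * (\<Sum>k\<in>{0..<int m}. t k $ \<alpha> $ \<beta>)" for \<alpha> \<beta>
  proof -
    define q \<sigma> where "q = (real n - 1) / real m" and "\<sigma> = (\<Sum>k\<in>{0..<int m}. s k $ \<alpha> $ \<beta>)"
    have ss: "(s k ** s l) $ \<alpha> $ \<beta> = real n * c (k - l) $ \<alpha> $ \<beta> + q * \<sigma>" for k l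
      by (simp add: S_S_nth q_def \<sigma>_def)
    \<comment> \<open>On the mixed blocks the index of \<open>c\<close> differs from the one wanted,
      but all these entries vanish.\<close>
    have c0: "c k $ \<alpha> $ \<beta> = 0" if "\<not> (\<alpha> \<in> \<Omega>1 \<longleftrightarrow> \<beta> \<in> \<Omega>1)" for k
      using that C_\<Omega>1[of \<alpha> \<beta> k] by (auto simp: adjacency_matrix_nth)
    \<comment> \<open>Rewriting only the terms with negative indices makes each subtracted
      correction equal to the added correction of the other product.\<close>
    have "(t i ** t j) $ \<alpha> $ \<beta> + (t j ** t i) $ \<alpha> $ \<beta> =
        real n * (c (i - j) $ \<alpha> $ \<beta> + c (j - i) $ \<alpha> $ \<beta>) + 2 * q * \<sigma>"
      unfolding T_T_nth ss S_\<Omega>1_S[of "- i" "- j"] S_\<Omega>1_S[of "- j" "- i"]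
      by (simp add: c0 distrib_left)
    then show ?thesis by (simp add: sum_t q_def \<sigma>_def)
  qed
  then show ?thesis by (simp add: vec_eq_iff)
qed

text \<open>Since \<open>C i\<close> preserves \<open>\<Omega>1\<close>, the sign chosen in
  \<open>t j\<close> depends only on the block of \<open>(\<alpha>, \<beta>)\<close>. Reversing it
  interchanges the two summands on the right.\<close>

lemma C_jordan_T: "c i ** t j + t j ** c i = t (i + j) + t (j - i)"
proof (clarsimp simp: vec_eq_iff)
  fix \<alpha> \<beta>
  define j' where "j' = (if \<alpha> \<in> \<Omega>1 \<or> \<beta> \<in> \<Omega>1 then j else - j)"
  have "(c i ** t j) $ \<alpha> $ \<beta> = (c i ** s j') $ \<alpha> $ \<beta>"
  proof -
    obtain \<gamma> where "(\<alpha>, \<gamma>) \<in> C i" using C_total by blast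
    then show ?thesis using C_\<Omega>1[of \<alpha> \<gamma> i] by (simp add: C_mult_nth t_nth j'_def)
  qed
  moreover have "(t j ** c i) $ \<alpha> $ \<beta> = (s j' ** c i) $ \<alpha> $ \<beta>"
  proof -
    obtain \<gamma> where "(\<gamma>, \<beta>) \<in> C i" using C_total C_uminus_iff by metis
    then show ?thesis using C_\<Omega>1[of \<gamma> \<beta> i] by (simp add: mult_C_nth t_nth j'_def)
  qed
  ultimately show "(c i ** t j) $ \<alpha> $ \<beta> + (t j ** c i) $ \<alpha> $ \<beta>
      = t (i + j) $ \<alpha> $ \<beta> + t (j - i) $ \<alpha> $ \<beta>"
    by (simp add: C_S S_C t_nth j'_def minus_diff_commute)
qed

section \<open>The rainbow of switched classes and its span\<close>

lemma D_0: "D 0 = Id"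
  by (simp add: D_def C_0)

lemma D_eq: "i mod int m = j mod int m \<or> i mod int m = - j mod int m \<Longrightarrow> D i = D j"
proof (elim disjE)
  assume "i mod int m = j mod int m"
  then show ?thesis using C_cong[of i j] C_cong[of "- i" "- j"] mod_minus_cong by (metis D_def)
next
  assume "i mod int m = - j mod int m"
  then have "C i = C (- j)" "C (- i) = C (- (- j))" by (metis C_cong mod_minus_cong)+
  then show ?thesis by (simp add: D_def Un_commute)
qed

lemma rainbow_classes: "rainbow classes"
proof -
  have D_D: "D i = D j" if "(\<alpha>, \<beta>) \<in> D i" "(\<alpha>, \<beta>) \<in> D j" for i j \<alpha> \<beta>
  proof -
    have "i mod int m = j mod int m \<or> i mod int m = - j mod int m
        \<or> - i mod int m = j mod int m \<or> - i mod int m = - j mod int m"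
      using that C_unique unfolding D_def by blast
    then show ?thesis using D_eq D_eq[of j i] by (metis minus_minus mod_minus_cong)
  qed
  have T_T: "T i = T j" if "(\<alpha>, \<beta>) \<in> T i" "(\<alpha>, \<beta>) \<in> T j" for i j \<alpha> \<beta>
  proof -
    \<comment> \<open>The sign in \<open>T\<close> is determined by the pair, so it is the same in
      both memberships.\<close>
    have "i mod int m = j mod int m \<or> - i mod int m = - j mod int m"
      using S_unique[OF that[unfolded T_def mem_Collect_eq case_prod_conv]] by presburger
    then have "i mod int m = j mod int m" "- i mod int m = - j mod int m"
      using mod_minus_cong by (metis minus_minus)+
    then have "S i = S j" "S (- i) = S (- j)" by (metis S_cong)+
    then show ?thesis by (simp add: T_def)
  qed
  have D_T: "(\<alpha>, \<beta>) \<notin> T j" if "(\<alpha>, \<beta>) \<in> D i" for i j \<alpha> \<beta>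
    using that C_S_disjoint by (auto simp: D_def T_def)
  have "(\<alpha>, \<beta>) \<in> \<Union>classes" for \<alpha> \<beta>
  proof -
    obtain k where "(\<alpha>, \<beta>) \<in> C k \<or> (\<alpha>, \<beta>) \<in> S k" using C_or_S by blast
    then have "(\<alpha>, \<beta>) \<in> D k \<or> (\<alpha>, \<beta>) \<in> T k \<or> (\<alpha>, \<beta>) \<in> T (- k)"
      by (auto simp: D_def T_def)
    then show ?thesis by blast
  qed
  moreover have "disjoint classes"
  proof (rule disjointI, rule ccontr)
    fix R R' assume R: "R \<in> classes" "R' \<in> classes" "R \<noteq> R'" "R \<inter> R' \<noteq> {}"
    then obtain \<alpha> \<beta> where "(\<alpha>, \<beta>) \<in> R" "(\<alpha>, \<beta>) \<in> R'" by auto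
    with R(1-3) show False using D_D[of \<alpha> \<beta>] T_T[of \<alpha> \<beta>] D_T[of \<alpha> \<beta>] by blast
  qed
  moreover have "{} \<notin> classes"
  proof
    assume "{} \<in> classes"
    then obtain k where "D k = {} \<or> T k = {}" by auto
    \<comment> \<open>A starting point in \<open>\<Omega>1\<close> makes \<open>T k\<close> agree
      with \<open>S k\<close> on its row.\<close>
    moreover obtain \<alpha> where \<alpha>: "\<alpha> \<in> \<Omega>1"
      using \<Omega>1_base C_0 by (metis pair_in_Id_conv)
    moreover obtain \<beta> \<gamma> where "(\<alpha>, \<beta>) \<in> C k" "(\<alpha>, \<gamma>) \<in> S k"
      using C_total S_total by metis
    then have "(\<alpha>, \<beta>) \<in> D k" "(\<alpha>, \<gamma>) \<in> T k" using \<alpha> by (simp_all add: D_def T_def)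
    ultimately show False by auto
  qed
  ultimately have "partition_on UNIV classes"
    unfolding partition_on_def by (metis UNIV_eq_I surj_pair)
  moreover have "Id \<in> classes" using D_0 by (metis UnI1 rangeI)
  then have "\<exists>\<D>\<subseteq>classes. Id = \<Union>\<D>" by (intro exI[of _ "{Id}"]) simp
  moreover have "R\<inverse> = R" if "R \<in> classes" for R
    using that S_sym C_uminus_iff by (auto simp: D_def T_def)
  ultimately show ?thesis by (simp add: rainbow_def)
qed

text \<open>If \<open>i\<close> and \<open>- i\<close> agree modulo \<open>m\<close>, the sum counts
  the same relation twice and the factor is 1/2; otherwise it is 1. The factor spares later span
  arguments this case distinction.\<close>

lemma D_scaled: obtains \<kappa> where "adjacency_matrix (D i) = \<kappa> *\<^sub>R (c i + c (- i))" "\<kappa> > 0"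
proof (cases "i mod int m = - i mod int m")
  case True
  then have "C (- i) = C i" by (metis C_cong)
  then have "adjacency_matrix (D i) = (1 / 2) *\<^sub>R (c i + c (- i))"
    by (simp add: vec_eq_iff D_def adjacency_matrix_nth)
  then show ?thesis using that[of "1 / 2"] by simp
next
  case False
  then have "adjacency_matrix (D i) = 1 *\<^sub>R (c i + c (- i))"
    using C_unique[of _ _ i "- i"] by (auto simp: vec_eq_iff D_def adjacency_matrix_nth)
  then show ?thesis using that[of 1] by simp
qed

abbreviation V where "V \<equiv> span (adjacency_matrix ` classes)"

lemma t_in_V: "t i \<in> V" by (intro span_base) auto

lemma sym_c_in_V: "c i + c (- i) \<in> V"
proof -
  obtain \<kappa> where "adjacency_matrix (D i) = \<kappa> *\<^sub>R (c i + c (- i))" "\<kappa> > 0" using D_scaled by blast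
  then have "c i + c (- i) = (1 / \<kappa>) *\<^sub>R adjacency_matrix (D i)" by simp
  moreover have "adjacency_matrix (D i) \<in> V" by (intro span_base) auto
  ultimately show ?thesis by (simp add: span_scale)
qed

lemma jordan_configuration_classes: "jordan_configuration classes"
proof (rule jordan_configuration_spanI[OF rainbow_classes])
  have DD: "adjacency_matrix (D i) ** adjacency_matrix (D j) \<in> V" for i j
  proof -
    obtain \<kappa> \<kappa>' where k: "adjacency_matrix (D i) = \<kappa> *\<^sub>R (c i + c (- i))"
      "adjacency_matrix (D j) = \<kappa>' *\<^sub>R (c j + c (- j))" using D_scaled by metis
    \<comment> \<open>The four products regroup into pairs with opposite indices, so the plain
      product is already in the span.\<close>
    have "adjacency_matrix (D i) ** adjacency_matrix (D j)
        = (\<kappa> * \<kappa>') *\<^sub>R ((c (i + j) + c (- (i + j))) + (c (i - j) + c (- (i - j))))"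
      unfolding k
      by (simp add: matrix_add_ldistrib matrix_add_rdistrib C_C scalar_matrix_assoc[symmetric]
        matrix_scalar_ac algebra_simps)
    then show ?thesis by (simp only: span_scale span_add sym_c_in_V)
  qed
  have DT: "adjacency_matrix (D i) ** t j + t j ** adjacency_matrix (D i) \<in> V" for i j
  proof -
    obtain \<kappa> where k: "adjacency_matrix (D i) = \<kappa> *\<^sub>R (c i + c (- i))" using D_scaled by metis
    have "adjacency_matrix (D i) ** t j + t j ** adjacency_matrix (D i)
        = \<kappa> *\<^sub>R ((c i ** t j + t j ** c i) + (c (- i) ** t j + t j ** c (- i)))"
      unfolding k
      by (simp add: matrix_add_ldistrib matrix_add_rdistrib scalar_matrix_assoc[symmetric]
        matrix_scalar_ac algebra_simps)
    then show ?thesis by (simp only: C_jordan_T span_scale span_add t_in_V)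
  qed
  have TT: "t i ** t j + t j ** t i \<in> V" for i j
    unfolding T_jordan_T by (intro span_add span_scale span_sum sym_c_in_V t_in_V)
  fix R R' assume "R \<in> classes" "R' \<in> classes"
  then show "adjacency_matrix R ** adjacency_matrix R' + adjacency_matrix R' ** adjacency_matrix R \<in> V"
    using DD DT TT by (auto simp: span_add add.commute)
qed

lemma jordan_scheme_classes: "jordan_scheme classes"
  using jordan_configuration_classes D_0 by (metis UnI1 jordan_scheme_def rangeI)

section \<open>Failure of every coherent algebra to realize the span\<close>

text \<open>The indicator of \<open>\<Omega>1\<close> is the sum of the columns of all
  \<open>c k\<close> at a base point \<open>\<omega>\<close>. Multiplying by \<open>s i\<close>
  gives the sum of all \<open>s k\<close> at \<open>(\<alpha>, \<omega>)\<close>, which is 1 because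
  no \<open>C k\<close> contains this pair.\<close>

lemma sum_s_\<Omega>1:
  assumes "\<alpha> \<notin> \<Omega>1"
  shows "(\<Sum>\<gamma>\<in>\<Omega>1. s i $ \<alpha> $ \<gamma>) = 1"
proof -
  obtain \<omega> where w: "\<And>\<alpha>. \<alpha> \<in> \<Omega>1 \<longleftrightarrow> (\<exists>i. (\<omega>, \<alpha>) \<in> C i)" using \<Omega>1_base by blast
  have w1: "\<omega> \<in> \<Omega>1" using w C_0 by (metis pair_in_Id_conv)
  have sum_C: "(\<Sum>k\<in>{0..<int m}. c k $ \<gamma> $ \<omega>) = of_bool (\<gamma> \<in> \<Omega>1)" for \<gamma>
  proof (cases "\<gamma> \<in> \<Omega>1")
    case True
    then obtain k where "(\<gamma>, \<omega>) \<in> C k" using w1 \<Omega>1_C by blast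
    then show ?thesis using sum_all[of \<gamma> \<omega>] sum_s_C[of \<gamma> \<omega> k] True by simp
  next
    case False
    then have "(\<gamma>, \<omega>) \<notin> C k" for k using C_\<Omega>1 w1 by blast
    then show ?thesis using False by (simp add: adjacency_matrix_nth)
  qed
  have "(\<Sum>\<gamma>\<in>\<Omega>1. s i $ \<alpha> $ \<gamma>) = (\<Sum>\<gamma>\<in>UNIV. s i $ \<alpha> $ \<gamma> * (\<Sum>k\<in>{0..<int m}. c k $ \<gamma> $ \<omega>))"
    by (simp add: sum_C of_bool_def if_distrib sum.If_cases cong: if_cong)
  also have "\<dots> = (\<Sum>k\<in>{0..<int m}. (s i ** c k) $ \<alpha> $ \<omega>)"
    unfolding matrix_matrix_mult_nth sum_distrib_left by (rule sum.swap)
  also have "\<dots> = (\<Sum>k\<in>{0..<int m}. s k $ \<alpha> $ \<omega>)"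
    unfolding S_C by (rule sum_reflect) (simp add: S_mod)
  also have "\<dots> = 1" using sum_all[of \<alpha> \<omega>] sum_C[of \<alpha>] assms by simp
  finally show ?thesis .
qed

text \<open>Away from \<open>\<Omega>1\<close>, each \<open>S i\<close> induces a perfect matching between \<open>\<Omega>1\<close> and any other class
  of \<open>E\<close>; composing two of these matchings is one of the permutations \<open>C k\<close>.\<close>
lemma S_\<Omega>1_S_C:
  assumes "\<alpha> \<notin> \<Omega>1" and "(\<alpha>, \<beta>) \<in> C k"
  shows "(s i ** e ** s j) $ \<alpha> $ \<beta> = of_bool (i mod int m = (j + k) mod int m)"
proof -
  have "s i $ \<alpha> $ \<gamma> * s j $ \<gamma> $ \<beta> = of_bool (i mod int m = (j + k) mod int m) * s i $ \<alpha> $ \<gamma>" for \<gamma>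
  proof -
    have "s j $ \<gamma> $ \<beta> = s (j + k) $ \<alpha> $ \<gamma>"
      using mult_C_nth[OF assms(2), of "s (j + k)" \<gamma>] S_sym[of \<gamma> \<alpha>]
      by (simp add: S_C adjacency_matrix_nth)
    moreover have "S i = S (j + k)" if "i mod int m = (j + k) mod int m"
      using that by (rule S_cong)
    ultimately show ?thesis
      using S_unique[of \<alpha> \<gamma> i "j + k"] by (auto simp: adjacency_matrix_nth)
  qed
  then show ?thesis
    unfolding S_\<Omega>1_S_nth by (simp only: sum_s_\<Omega>1[OF assms(1)] mult_1_right flip: sum_distrib_left)
qed

text \<open>On a pair in \<open>C k\<close> the sum of all \<open>s\<close> vanishes, and each
  surviving term is a comparison of residues.\<close>

lemma T_T_C_nth:
  assumes "(\<alpha>, \<beta>) \<in> C k"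
  shows "(t i ** t j) $ \<alpha> $ \<beta> =
    (if \<alpha> \<in> \<Omega>1 then real n * of_bool (k mod int m = (i - j) mod int m)
     else real n * of_bool (k mod int m = (j - i) mod int m)
       + of_bool (i mod int m = (j + k) mod int m) - of_bool (- i mod int m = (- j + k) mod int m))"
proof -
  have "c l $ \<alpha> $ \<beta> = of_bool (k mod int m = l mod int m)" for l
    using assms C_unique[OF assms, of l] C_cong[of k l] by (auto simp: adjacency_matrix_nth)
  then show ?thesis
    using C_\<Omega>1[OF assms]
    by (simp add: T_T_nth S_S_nth sum_s_C[OF assms] S_\<Omega>1_S_C[OF _ assms])
qed

lemma proper_jordan_configuration_classes:
  assumes "m \<ge> 3" and "n \<ge> 2"
  shows "proper_jordan_configuration classes"
  unfolding proper_jordan_configuration_def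
proof (intro conjI notI jordan_configuration_classes)
  assume "\<exists>\<A>. coherent_algebra \<A> \<and> V = symmetrization \<A>"
  then obtain \<A> where ca: "coherent_algebra \<A>" and V: "V = symmetrization \<A>" by blast
  have V_\<A>: "M \<in> V \<Longrightarrow> M \<in> \<A>" for M using V by (simp add: symmetrization_def)
  define X where "X = t 1 ** t 0"
  define Y where "Y = X * adjacency_matrix (D 1)"
  \<comment> \<open>Here \<open>m \<ge> 3\<close> enters: \<open>C 1\<close> and
    \<open>C (- 1)\<close> are different relations.\<close>
  have ne: "1 mod int m \<noteq> - 1 mod int m"
    using assms by (simp add: zmod_zminus1_eq_if)
  have "t 1 \<in> \<A>" "t 0 \<in> \<A>" "adjacency_matrix (D 1) \<in> \<A>"
    by (intro V_\<A> span_base; simp)+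
  then have "Y \<in> \<A>" using ca unfolding X_def Y_def coherent_algebra_def by blast
  then have "Y ** transpose Y \<in> \<A>" using ca unfolding coherent_algebra_def by blast
  then have YV: "Y ** transpose Y \<in> V"
    by (simp add: V symmetrization_def matrix_transpose_mul)
  have diag: "(Y ** transpose Y) $ \<alpha> $ \<alpha>
      = (if \<alpha> \<in> \<Omega>1 then (real n)\<^sup>2 else 1 + (real n - 1)\<^sup>2)" for \<alpha>
  proof -
    \<comment> \<open>Outside \<open>\<Omega>1\<close> the correction terms move one unit of the
      weight \<open>n\<close> from \<open>C (- 1)\<close> to \<open>C 1\<close>.\<close>
    have 1: "X $ \<alpha> $ \<beta> = (if \<alpha> \<in> \<Omega>1 then real n else 1)" if "(\<alpha>, \<beta>) \<in> C 1" for \<beta>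
      using T_T_C_nth[OF that, of 1 0] ne by (simp add: X_def)
    have 2: "X $ \<alpha> $ \<beta> = (if \<alpha> \<in> \<Omega>1 then 0 else real n - 1)" if "(\<alpha>, \<beta>) \<in> C (- 1)" for \<beta>
      using T_T_C_nth[OF that, of 1 0] ne by (simp add: X_def)
    have "(Y $ \<alpha> $ \<beta>)\<^sup>2 = (if \<alpha> \<in> \<Omega>1 then (real n)\<^sup>2 * c 1 $ \<alpha> $ \<beta>
        else c 1 $ \<alpha> $ \<beta> + (real n - 1)\<^sup>2 * c (- 1) $ \<alpha> $ \<beta>)" for \<beta>
      using 1[of \<beta>] 2[of \<beta>] C_unique[of \<alpha> \<beta> 1 "- 1"] ne
      by (auto simp: Y_def D_def adjacency_matrix_nth)
    moreover have "(Y ** transpose Y) $ \<alpha> $ \<alpha> = (\<Sum>\<beta>\<in>UNIV. (Y $ \<alpha> $ \<beta>)\<^sup>2)"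
      by (simp add: matrix_matrix_mult_nth transpose_def power2_eq_square)
    ultimately show ?thesis by (simp add: sum.distrib sum_c flip: sum_distrib_left)
  qed
  obtain \<alpha> where \<alpha>: "\<alpha> \<in> \<Omega>1" using \<Omega>1_base C_0 by (metis pair_in_Id_conv)
  obtain \<beta> where "(\<alpha>, \<beta>) \<in> S 0" using S_total by blast
  then have \<beta>: "\<beta> \<notin> \<Omega>1" using \<Omega>1_not_S[OF \<alpha>] by blast
  have "partition_on UNIV classes" using rainbow_classes by (simp add: rainbow_def)
  then have "(Y ** transpose Y) $ \<alpha> $ \<alpha> = (Y ** transpose Y) $ \<beta> $ \<beta>"
    by (rule span_adjacency_matrix_const[OF _ YV, of "D 0"]) (blast | simp add: D_0)+
  \<comment> \<open>Constancy on the class \<open>D 0 = Id\<close> forces this equation, whose only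
    solution is \<open>n = 1\<close>.\<close>
  then have "(real n)\<^sup>2 = 1 + (real n - 1)\<^sup>2" using diag[of \<alpha>] diag[of \<beta>] \<alpha> \<beta> by simp
  then show False using assms by (simp add: power2_eq_square algebra_simps)
qed

end

section \<open>Transfer to families indexed by residues\<close>

text \<open>For \<open>m \<le> 2\<close> or \<open>n = 1\<close> every \<open>T i\<close> equals
  \<open>S i\<close>, and the span is the symmetrization of the algebra of the original scheme;
  hence properness is claimed for \<open>m \<ge> 3\<close> and \<open>n \<ge> 2\<close>.\<close>

theorem theorem5p2:
  fixes m n :: nat
    and C S Sb Sw D T :: "int \<Rightarrow> ('a::finite \<times> 'a) set"
    and E :: "('a \<times> 'a) set"
    and \<Omega>1 \<Omega>2 :: "'a set"
  assumes "m > 0" and "n > 0" and "m dvd n - 1"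
    and "association_scheme (C ` {0..<int m} \<union> S ` {0..<int m})"
    and "CARD('a) = m * (n + 1)"
    and "C 0 = Id"
    and "\<And>i j. i \<in> {0..<int m} \<Longrightarrow> j \<in> {0..<int m} \<Longrightarrow>
           adjacency_matrix (C i) ** adjacency_matrix (C j)
           = adjacency_matrix (C ((i + j) mod int m))"
    and "\<And>i j. i \<in> {0..<int m} \<Longrightarrow> j \<in> {0..<int m} \<Longrightarrow>
           adjacency_matrix (C i) ** adjacency_matrix (S j)
           = adjacency_matrix (S ((i + j) mod int m))"
    and "\<And>i j. i \<in> {0..<int m} \<Longrightarrow> j \<in> {0..<int m} \<Longrightarrow>
           adjacency_matrix (S j) ** adjacency_matrix (C i)
           = adjacency_matrix (S ((j - i) mod int m))"
    and "\<And>i j. i \<in> {0..<int m} \<Longrightarrow> j \<in> {0..<int m} \<Longrightarrow>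
           adjacency_matrix (S i) ** adjacency_matrix (S j)
           = real n *\<^sub>R adjacency_matrix (C ((i - j) mod int m))
             + ((real n - 1) / real m) *\<^sub>R (\<Sum>k\<in>{0..<int m}. adjacency_matrix (S k))"
    and "E = (\<Union>i\<in>{0..<int m}. C i)"
    and "\<Omega>1 \<in> UNIV // E" and "\<Omega>2 = UNIV - \<Omega>1"
    and "\<And>i. i \<in> {0..<int m} \<Longrightarrow> Sb i = S i \<inter> (\<Omega>1 \<times> \<Omega>2 \<union> \<Omega>2 \<times> \<Omega>1)"
    and "\<And>i. i \<in> {0..<int m} \<Longrightarrow> Sw i = S i \<inter> (\<Omega>2 \<times> \<Omega>2)"
    and "\<And>i. i \<in> {0..int m div 2} \<Longrightarrow> D i = C i \<union> C ((- i) mod int m)"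
    and "\<And>i. i \<in> {0..<int m} \<Longrightarrow> T i = Sb i \<union> Sw ((- i) mod int m)"
  shows "jordan_scheme (D ` {0..int m div 2} \<union> T ` {0..<int m}) \<and>
         (m \<ge> 3 \<and> n \<ge> 2 \<longrightarrow>
            proper_jordan_configuration (D ` {0..int m div 2} \<union> T ` {0..<int m}))"
proof -
  \<comment> \<open>The given families are constrained only on \<open>0..m-1\<close>; their periodic
    extensions fit the locale.\<close>
  define C' where "C' i = C (i mod int m)" for i
  define S' where "S' i = S (i mod int m)" for i
  have m: "0 < int m" using assms(1) by simp
  have mem: "i mod int m \<in> {0..<int m}" for i using m by simp
  have ranges: "range C' = C ` {0..<int m}" "range S' = S ` {0..<int m}"
    using mem unfolding C'_def S'_def by (auto simp: image_iff) (metis atLeastLessThan_iff mod_pos_pos_trivial)+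
  have sum_S': "(\<Sum>k\<in>{0..<int m}. adjacency_matrix (S k)) = (\<Sum>k\<in>{0..<int m}. adjacency_matrix (S' k))"
    by (intro sum.cong) (simp_all add: S'_def)
  have E_C': "E = (\<Union>i. C' i)" unfolding assms(11) ranges(1)[symmetric] by simp
  interpret switched_dihedral_scheme m n C' S' \<Omega>1
  proof
    show "adjacency_matrix (S' i) ** adjacency_matrix (S' j)
        = real n *\<^sub>R adjacency_matrix (C' (i - j))
          + ((real n - 1) / real m) *\<^sub>R (\<Sum>k\<in>{0..<int m}. adjacency_matrix (S' k))" for i j
      using assms(10)[OF mem mem, of i j] unfolding sum_S' by (simp add: C'_def S'_def mod_simps)
    show "\<Omega>1 \<in> UNIV // (\<Union>i. C' i)" using assms(12) by (simp add: E_C')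
    show "association_scheme (range C' \<union> range S')" using assms(4) by (simp add: ranges)
  qed (use assms(1,2,5,6) assms(7-9)[OF mem mem] in \<open>simp_all add: C'_def S'_def mod_simps\<close>)
  let ?D = "switched_dihedral_scheme.D C'" and ?T = "switched_dihedral_scheme.T S' \<Omega>1"
  have "D i = ?D i" if "i \<in> {0..int m div 2}" for i
  proof -
    have "i mod int m = i" using that m by (intro mod_pos_pos_trivial) auto
    then show ?thesis using assms(16)[OF that] by (simp add: D_def C'_def)
  qed
  then have "D ` {0..int m div 2} = ?D ` {0..int m div 2}" by (intro image_cong refl)
  also have "\<dots> = range ?D"
  proof (intro equalityI subsetI)
    fix R assume "R \<in> range ?D"
    then obtain i where R: "R = ?D i" by auto
    define r where "r = i mod int m"
    have r: "0 \<le> r" "r < int m" using m by (simp_all add: r_def)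
    have "R = ?D r" "R = ?D (int m - r)"
      unfolding R by (rule D_eq; simp add: r_def mod_simps)+
    \<comment> \<open>One of the representatives \<open>r\<close> and \<open>m - r\<close> is at
      most half of \<open>m\<close>.\<close>
    moreover have "r \<in> {0..int m div 2} \<or> int m - r \<in> {0..int m div 2}" using r by auto
    ultimately show "R \<in> ?D ` {0..int m div 2}" by blast
  qed auto
  finally have "D ` {0..int m div 2} = range ?D" .
  moreover have "T i = ?T i" if i: "i \<in> {0..<int m}" for i
  proof -
    have "T i = S' i \<inter> (\<Omega>1 \<times> \<Omega>2 \<union> \<Omega>2 \<times> \<Omega>1) \<union> S' (- i) \<inter> (\<Omega>2 \<times> \<Omega>2)"
      using i assms(14)[OF i] assms(15)[OF mem] assms(17)[OF i] by (simp add: S'_def)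
    \<comment> \<open>Pairs inside \<open>\<Omega>1\<close>, absent from the left side, are absent
      from \<open>T i\<close> as well.\<close>
    also have "\<dots> = ?T i"
      using \<Omega>1_not_S by (auto simp: T_def assms(13) split: if_splits)
    finally show ?thesis .
  qed
  then have "T ` {0..<int m} = ?T ` {0..<int m}" by (intro image_cong refl)
  moreover have "?T ` {0..<int m} = range ?T"
  proof (intro equalityI subsetI)
    fix R assume "R \<in> range ?T"
    then obtain i where "R = ?T i" by auto
    also have "?T i = ?T (i mod int m)" by (simp add: T_def S'_def mod_simps)
    finally show "R \<in> ?T ` {0..<int m}" using mem by blast
  qed auto
  ultimately show ?thesis
    using jordan_scheme_classes proper_jordan_configuration_classes by simp
qed

end
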